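(* Let $\alpha,\beta,\gamma\in\mathbb{R}$ with $\gamma\neq 0$. Let $G_2$ be the connected, simply connected three-dimensional Lie group with left-invariant Lorentzian metric $g$ whose Lie algebra has a pseudo-orthonormal basis $\{e_1,e_2,e_3\}$, $e_3$ timelike, with $$[e_1,e_2]=\gamma e_2-\beta e_3,\quad [e_1,e_3]=-\beta e_2-\gamma e_3,\quad [e_2,e_3]=\alpha e_1.$$ Then for every $V=\lambda_1e_1+\lambda_2e_2+\lambda_3e_3$ with $\lambda_1,\lambda_2,\lambda_3\in\mathbb{R}$, and every $\lambda\in\mathbb{R}$, $(G_2,V,g)$ is not a left-invariant Riemann soliton with constant $\lambda$.
   Context: Elements of the Lie algebra are identified with left-invariant vector fields. A pseudo-orthonormal basis $\{e_1,e_2,e_3\}$ with $e_3$ timelike means $g(e_1,e_1)=g(e_2,e_2)=1$, $g(e_3,e_3)=-1$, and $g(e_i,e_j)=0$ for $i\ne j$. Let $\nabla$ be the Levi-Civita connection of $g$, with curvature $R(X,Y)Z=\nabla_X\nabla_YZ-\nabla_Y\nabla_XZ-\nabla_{[X,Y]}Z$, and set $R(X,Y,Z,W)=-g(R(X,Y)Z,W)$. For $(0,2)$-tensors $T_1,T_2$ the Kulkarni-Nomizu product is $$(T_1\wedge T_2)(X,Y,Z,W)=T_1(X,W)T_2(Y,Z)+T_1(Y,Z)T_2(X,W)-T_1(X,Z)T_2(Y,W)-T_1(Y,W)T_2(X,Z).$$ $L_Vg$ denotes the Lie derivative of $g$ along $V$. For a left-invariant vector field $V$ and a real constant $\lambda$,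 $(G,V,g)$ is a left-invariant Riemann soliton with constant $\lambda$ if $R+\frac12 L_Vg\wedge g=\frac{\lambda}{2}g\wedge g$, i.e. for all vector fields $X,Y,Z,W$, $$2R(X,Y,Z,W)+g(X,W)(L_Vg)(Y,Z)+g(Y,Z)(L_Vg)(X,W)-g(X,Z)(L_Vg)(Y,W)-g(Y,W)(L_Vg)(X,Z)=2\lambda[g(X,W)g(Y,Z)-g(X,Z)g(Y,W)].$$ *)

theory Defs
  imports "HOL-Analysis.Analysis" "HOL-Library.Function_Algebras"
begin

section \<open>Smooth manifolds\<close>

text \<open>\<open>Ck_on k S f\<close>: continuous partial derivatives up to order \<open>k\<close> on the open set \<open>S\<close>.\<close>

fun Ck_on :: "nat \<Rightarrow> 'a::euclidean_space set \<Rightarrow> ('a \<Rightarrow> 'b::real_normed_vector) \<Rightarrow> bool" where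
  "Ck_on 0 S f \<longleftrightarrow> continuous_on S f"
| "Ck_on (Suc k) S f \<longleftrightarrow>
     (\<forall>x\<in>S. f differentiable (at x)) \<and> (\<forall>v. Ck_on k S (\<lambda>x. frechet_derivative f (at x) v))"

definition smooth_on :: "'a::euclidean_space set \<Rightarrow> ('a \<Rightarrow> 'b::real_normed_vector) \<Rightarrow> bool" where
  "smooth_on S f \<longleftrightarrow> (\<forall>k. Ck_on k S f)"

text \<open>A chart is a pair \<open>(U, \<phi>)\<close>; the map \<open>\<phi>\<close> is relevant on the open set \<open>U\<close> only, and its
  inverse is \<open>inv_into U \<phi>\<close>. An atlas is a set of charts, not required to be maximal. The
  underlying set of a manifold is a whole type.\<close>

type_synonym ('m, 'e) chart = "'m set \<times> ('m \<Rightarrow> 'e)"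

definition smooth_manifold ::
    "('m::{t2_space,second_countable_topology}, 'e::euclidean_space) chart set \<Rightarrow> bool" where
  "smooth_manifold A \<longleftrightarrow>
     (\<forall>(U, \<phi>)\<in>A. open U \<and> open (\<phi> ` U) \<and> homeomorphism U (\<phi> ` U) \<phi> (inv_into U \<phi>)) \<and>
     (\<Union>(U, \<phi>)\<in>A. U) = UNIV \<and>
     (\<forall>(U, \<phi>)\<in>A. \<forall>(V, \<psi>)\<in>A. smooth_on (\<phi> ` (U \<inter> V)) (\<psi> \<circ> inv_into U \<phi>))"

definition smooth_map ::
    "('m::topological_space, 'd::euclidean_space) chart set \<Rightarrow>
     ('n::topological_space, 'e::euclidean_space) chart set \<Rightarrow> ('m \<Rightarrow> 'n) \<Rightarrow> bool" where
  "smooth_map A B F \<longleftrightarrow> continuous_on UNIV F \<and>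
     (\<forall>(U, \<phi>)\<in>A. \<forall>(V, \<psi>)\<in>B. smooth_on (\<phi> ` (U \<inter> F -` V)) (\<psi> \<circ> F \<circ> inv_into U \<phi>))"

definition prod_atlas ::
    "('m, 'd) chart set \<Rightarrow> ('n, 'e) chart set \<Rightarrow> ('m \<times> 'n, 'd \<times> 'e) chart set" where
  "prod_atlas A B = {(U \<times> V, map_prod \<phi> \<psi>) | U \<phi> V \<psi>. (U, \<phi>) \<in> A \<and> (V, \<psi>) \<in> B}"

definition smooth_functions :: "('m, 'e::euclidean_space) chart set \<Rightarrow> ('m \<Rightarrow> real) set" where
  "smooth_functions A = {f. \<forall>(U, \<phi>)\<in>A. smooth_on (\<phi> ` U) (f \<circ> inv_into U \<phi>)}"


section \<open>Tangent vectors and vector fields\<close>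

text \<open>A tangent vector at \<open>p\<close> is the functional taking a smooth function \<open>f\<close> to its directional
  derivative at \<open>p\<close>, in some chart, along some coordinate vector \<open>w\<close>. By the chain rule the chart
  does not matter. Functionals are set to \<open>0\<close> outside the smooth functions, so that equality
  of tangent vectors is equality of functions.\<close>

type_synonym 'm tvec = "('m \<Rightarrow> real) \<Rightarrow> real"
type_synonym 'm vfield = "'m \<Rightarrow> 'm tvec"

definition tangent_space ::
    "('m, 'e::euclidean_space) chart set \<Rightarrow> 'm \<Rightarrow> 'm tvec set" where
  "tangent_space A p = {u. \<exists>(U, \<phi>)\<in>A. p \<in> U \<and> (\<exists>w. u = (\<lambda>f.
     if f \<in> smooth_functions A then frechet_derivative (f \<circ> inv_into U \<phi>) (at (\<phi> p)) w else 0))}"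

definition tscale :: "real \<Rightarrow> 'm tvec \<Rightarrow> 'm tvec" where
  "tscale c u = (\<lambda>f. c * u f)"

definition differential ::
    "('m, 'e::euclidean_space) chart set \<Rightarrow> ('m \<Rightarrow> 'm) \<Rightarrow> 'm tvec \<Rightarrow> 'm tvec" where
  "differential A F u = (\<lambda>f. if f \<in> smooth_functions A then u (f \<circ> F) else 0)"

definition vector_field :: "('m, 'e::euclidean_space) chart set \<Rightarrow> 'm vfield \<Rightarrow> bool" where
  "vector_field A X \<longleftrightarrow> (\<forall>p. X p \<in> tangent_space A p) \<and>
     (\<forall>f\<in>smooth_functions A. (\<lambda>p. X p f) \<in> smooth_functions A)"

definition fscale :: "('m \<Rightarrow> real) \<Rightarrow> 'm vfield \<Rightarrow> 'm vfield" (infixr "\<odot>" 75) where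
  "h \<odot> X = (\<lambda>p. tscale (h p) (X p))"

abbreviation cscale :: "real \<Rightarrow> 'm vfield \<Rightarrow> 'm vfield" (infixr "\<odot>\<^sub>c" 75) where
  "c \<odot>\<^sub>c X \<equiv> (\<lambda>_. c) \<odot> X"

text \<open>The derivative of \<open>f\<close> along \<open>X\<close>.\<close>

definition deriv_along :: "'m vfield \<Rightarrow> ('m \<Rightarrow> real) \<Rightarrow> 'm \<Rightarrow> real" where
  "deriv_along X f = (\<lambda>p. X p f)"

definition lie_bracket :: "'m vfield \<Rightarrow> 'm vfield \<Rightarrow> 'm vfield" where
  "lie_bracket X Y = (\<lambda>p f. X p (deriv_along Y f) - Y p (deriv_along X f))"


section \<open>Lorentzian metrics, Levi-Civita connection and curvature\<close>

type_synonym 'm metric = "'m \<Rightarrow> 'm tvec \<Rightarrow> 'm tvec \<Rightarrow> real"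

text \<open>A \<open>(0,2)\<close>-tensor, as a map on vector fields.\<close>
type_synonym 'm tensor2 = "'m vfield \<Rightarrow> 'm vfield \<Rightarrow> 'm \<Rightarrow> real"
type_synonym 'm tensor4 = "'m vfield \<Rightarrow> 'm vfield \<Rightarrow> 'm vfield \<Rightarrow> 'm vfield \<Rightarrow> 'm \<Rightarrow> real"

definition pseudo_riemannian_metric ::
    "('m, 'e::euclidean_space) chart set \<Rightarrow> 'm metric \<Rightarrow> bool" where
  "pseudo_riemannian_metric A g \<longleftrightarrow>
     (\<forall>p. \<forall>u\<in>tangent_space A p. \<forall>v\<in>tangent_space A p. g p u v = g p v u) \<and>
     (\<forall>p. \<forall>u\<in>tangent_space A p. \<forall>v\<in>tangent_space A p. \<forall>w\<in>tangent_space A p. \<forall>a b.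
        g p (tscale a u + tscale b v) w = a * g p u w + b * g p v w) \<and>
     (\<forall>p. \<forall>u\<in>tangent_space A p. (\<forall>v\<in>tangent_space A p. g p u v = 0) \<longrightarrow> u = 0) \<and>
     (\<forall>X Y. vector_field A X \<and> vector_field A Y \<longrightarrow> (\<lambda>p. g p (X p) (Y p)) \<in> smooth_functions A)"

text \<open>Index one: each tangent space splits as a negative definite line plus its positive
  definite orthogonal complement.\<close>

definition lorentzian_metric :: "('m, 'e::euclidean_space) chart set \<Rightarrow> 'm metric \<Rightarrow> bool" where
  "lorentzian_metric A g \<longleftrightarrow> pseudo_riemannian_metric A g \<and>
     (\<forall>p. \<exists>t\<in>tangent_space A p. g p t t < 0 \<and>
        (\<forall>u\<in>tangent_space A p. g p t u = 0 \<and> u \<noteq> 0 \<longrightarrow> g p u u > 0))"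

definition metric_tensor :: "'m metric \<Rightarrow> 'm tensor2" where
  "metric_tensor g X Y = (\<lambda>p. g p (X p) (Y p))"

definition levi_civita_connection ::
    "('m, 'e::euclidean_space) chart set \<Rightarrow> 'm metric \<Rightarrow> ('m vfield \<Rightarrow> 'm vfield \<Rightarrow> 'm vfield) \<Rightarrow> bool"
  where
  "levi_civita_connection A g nab \<longleftrightarrow>
     (\<forall>X Y. vector_field A X \<and> vector_field A Y \<longrightarrow> vector_field A (nab X Y)) \<and>
     (\<forall>X Y Z h. vector_field A X \<and> vector_field A Y \<and> vector_field A Z \<and> h \<in> smooth_functions A \<longrightarrow>
        nab (X + Y) Z = nab X Z + nab Y Z \<and>
        nab (h \<odot> X) Z = h \<odot> nab X Z \<and>
        nab X (Y + Z) = nab X Y + nab X Z \<and>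
        nab X (h \<odot> Y) = deriv_along X h \<odot> Y + h \<odot> nab X Y) \<and>
     (\<forall>X Y. vector_field A X \<and> vector_field A Y \<longrightarrow> nab X Y - nab Y X = lie_bracket X Y) \<and>
     (\<forall>X Y Z. vector_field A X \<and> vector_field A Y \<and> vector_field A Z \<longrightarrow>
        deriv_along X (metric_tensor g Y Z) =
          metric_tensor g (nab X Y) Z + metric_tensor g Y (nab X Z))"

definition curvature ::
    "('m vfield \<Rightarrow> 'm vfield \<Rightarrow> 'm vfield) \<Rightarrow> 'm vfield \<Rightarrow> 'm vfield \<Rightarrow> 'm vfield \<Rightarrow> 'm vfield" where
  "curvature nab X Y Z = nab X (nab Y Z) - nab Y (nab X Z) - nab (lie_bracket X Y) Z"

definition curvature_tensor ::
    "'m metric \<Rightarrow> ('m vfield \<Rightarrow> 'm vfield \<Rightarrow> 'm vfield) \<Rightarrow> 'm tensor4" where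
  "curvature_tensor g nab X Y Z W = - metric_tensor g (curvature nab X Y Z) W"

definition lie_derivative :: "'m vfield \<Rightarrow> 'm tensor2 \<Rightarrow> 'm tensor2" where
  "lie_derivative V T X Y = deriv_along V (T X Y) - T (lie_bracket V X) Y - T X (lie_bracket V Y)"

definition kulkarni_nomizu :: "'m tensor2 \<Rightarrow> 'm tensor2 \<Rightarrow> 'm tensor4" where
  "kulkarni_nomizu T1 T2 X Y Z W =
     T1 X W * T2 Y Z + T1 Y Z * T2 X W - T1 X Z * T2 Y W - T1 Y W * T2 X Z"

text \<open>The Riemann soliton equation \<open>R + 1/2 L\<^sub>V g \<and> g = \<lambda>/2 g \<and> g\<close>.\<close>

definition riemann_soliton ::
    "('m, 'e::euclidean_space) chart set \<Rightarrow> 'm metric \<Rightarrow> ('m vfield \<Rightarrow> 'm vfield \<Rightarrow> 'm vfield) \<Rightarrow>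
     'm vfield \<Rightarrow> real \<Rightarrow> bool" where
  "riemann_soliton A g nab V lam \<longleftrightarrow>
     (\<forall>X Y Z W. vector_field A X \<and> vector_field A Y \<and> vector_field A Z \<and> vector_field A W \<longrightarrow>
        (\<forall>p. curvature_tensor g nab X Y Z W p
             + 1 / 2 * kulkarni_nomizu (lie_derivative V (metric_tensor g)) (metric_tensor g) X Y Z W p
           = lam / 2 * kulkarni_nomizu (metric_tensor g) (metric_tensor g) X Y Z W p))"


section \<open>Lie groups\<close>

definition lie_group ::
    "('g::{t2_space,second_countable_topology}, 'e::euclidean_space) chart set \<Rightarrow>
     ('g \<Rightarrow> 'g \<Rightarrow> 'g) \<Rightarrow> 'g \<Rightarrow> ('g \<Rightarrow> 'g) \<Rightarrow> bool" where
  "lie_group A mul e iv \<longleftrightarrow> group mul e iv \<and> smooth_manifold A \<and>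
     smooth_map (prod_atlas A A) A (\<lambda>(x, y). mul x y) \<and> smooth_map A A iv"

definition left_invariant ::
    "('g, 'e::euclidean_space) chart set \<Rightarrow> ('g \<Rightarrow> 'g \<Rightarrow> 'g) \<Rightarrow> 'g vfield \<Rightarrow> bool" where
  "left_invariant A mul X \<longleftrightarrow> vector_field A X \<and>
     (\<forall>a p. X (mul a p) = differential A (mul a) (X p))"

definition left_invariant_metric ::
    "('g, 'e::euclidean_space) chart set \<Rightarrow> ('g \<Rightarrow> 'g \<Rightarrow> 'g) \<Rightarrow> 'g metric \<Rightarrow> bool" where
  "left_invariant_metric A mul g \<longleftrightarrow>
     (\<forall>a p. \<forall>u\<in>tangent_space A p. \<forall>v\<in>tangent_space A p.
        g (mul a p) (differential A (mul a) u) (differential A (mul a) v) = g p u v)"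

text \<open>The Lie algebra is the space of left-invariant vector fields.\<close>

definition lie_algebra_basis ::
    "('g, 'e::euclidean_space) chart set \<Rightarrow> ('g \<Rightarrow> 'g \<Rightarrow> 'g) \<Rightarrow>
     'g vfield \<Rightarrow> 'g vfield \<Rightarrow> 'g vfield \<Rightarrow> bool" where
  "lie_algebra_basis A mul e1 e2 e3 \<longleftrightarrow>
     left_invariant A mul e1 \<and> left_invariant A mul e2 \<and> left_invariant A mul e3 \<and>
     (\<forall>X. left_invariant A mul X \<longrightarrow>
        (\<exists>!c::real^3. X = c $ 1 \<odot>\<^sub>c e1 + c $ 2 \<odot>\<^sub>c e2 + c $ 3 \<odot>\<^sub>c e3))"

definition pseudo_orthonormal ::
    "'g metric \<Rightarrow> 'g vfield \<Rightarrow> 'g vfield \<Rightarrow> 'g vfield \<Rightarrow> bool" where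
  "pseudo_orthonormal g e1 e2 e3 \<longleftrightarrow> (\<forall>p.
     g p (e1 p) (e1 p) = 1 \<and> g p (e2 p) (e2 p) = 1 \<and> g p (e3 p) (e3 p) = -1 \<and>
     g p (e1 p) (e2 p) = 0 \<and> g p (e1 p) (e3 p) = 0 \<and> g p (e2 p) (e3 p) = 0)"

end

theory Submission
  imports Defs
begin

text \<open>In the left-invariant frame all components of the soliton equation are constants, computed
  from the Koszul formula. The component \<open>(e1, e2, e3, e1)\<close> does not involve \<open>V\<close> and reads
  \<open>\<gamma> (\<alpha> - 2 \<beta>) = 0\<close>, so \<open>\<alpha> = 2 \<beta>\<close>. Then the components \<open>(e1, e2, e2, e1)\<close> and
  \<open>(e1, e3, e3, e1)\<close> give \<open>\<lambda> = \<gamma>\<^sup>2 + \<beta>\<^sup>2\<close>, and \<open>(e2, e3, e3, e2)\<close> gives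
  \<open>\<lambda> = - (\<gamma>\<^sup>2 + \<beta>\<^sup>2)\<close>, which is impossible for \<open>\<gamma> \<noteq> 0\<close>. Products
  \<open>g(\<nabla>\<^sub>i e\<^sub>j, \<nabla>\<^sub>k e\<^sub>l)\<close> are expanded in the frame, which spans each tangent space because
  a single chart identifies that space with a quotient of \<open>\<real>\<^sup>3\<close>.\<close>

section \<open>Calculus of \<open>Ck_on\<close> on open sets and linear combinations of smooth
  functions\<close>

lemma Ck_on_cong:
  fixes f g :: "'a::euclidean_space \<Rightarrow> 'b::real_normed_vector"
  assumes "open S" "\<And>x. x \<in> S \<Longrightarrow> f x = g x" "Ck_on k S f"
  shows "Ck_on k S g"
  using assms(2,3)
proof (induction k arbitrary: f g)
  case 0
  then show ?case by (auto cong: continuous_on_cong)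
next
  case (Suc k)
  \<comment> \<open>\<open>S\<close> is open, so \<open>f\<close> and \<open>g\<close> agree near
    \<open>x\<close> and share their derivative there, whatever they do off
    \<open>S\<close>.\<close>
  have D: "(g has_derivative frechet_derivative f (at x)) (at x)" if "x \<in> S" for x
  proof -
    have "(f has_derivative frechet_derivative f (at x)) (at x)"
      using Suc.prems(2) that by (simp add: frechet_derivative_works)
    then show ?thesis
      by (rule has_derivative_transform_within_open[OF _ \<open>open S\<close> that]) (use Suc.prems in auto)
  qed
  have "Ck_on k S (\<lambda>x. frechet_derivative g (at x) v)" for v
  proof (rule Suc.IH)
    show "Ck_on k S (\<lambda>x. frechet_derivative f (at x) v)" using Suc.prems(2) by simp
    show "frechet_derivative f (at x) v = frechet_derivative g (at x) v" if "x \<in> S" for x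
      using frechet_derivative_at[OF D[OF that]] by simp
  qed
  then show ?case using D by (auto simp: differentiable_def)
qed

lemma Ck_on_linear_combination:
  fixes f g :: "'a::euclidean_space \<Rightarrow> 'b::real_normed_vector"
  assumes "open S" "Ck_on k S f" "Ck_on k S g"
  shows "Ck_on k S (\<lambda>x. a *\<^sub>R f x + b *\<^sub>R g x)"
  using assms(2,3)
proof (induction k arbitrary: f g)
  case 0
  then show ?case by (auto intro!: continuous_intros)
next
  case (Suc k)
  have D: "((\<lambda>x. a *\<^sub>R f x + b *\<^sub>R g x) has_derivative
      (\<lambda>v. a *\<^sub>R frechet_derivative f (at x) v + b *\<^sub>R frechet_derivative g (at x) v)) (at x)"
    if "x \<in> S" for x
    using Suc.prems that
    by (auto simp: frechet_derivative_works intro!: derivative_intros)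
  have "Ck_on k S (\<lambda>x. frechet_derivative (\<lambda>x. a *\<^sub>R f x + b *\<^sub>R g x) (at x) v)" for v
  \<comment> \<open>The derivative of the combination is known only at points of \<open>S\<close>,
    where \<open>f\<close> and \<open>g\<close> are differentiable; this is why congruence on
    \<open>S\<close> is required.\<close>
  proof (rule Ck_on_cong[OF \<open>open S\<close>])
    show "Ck_on k S (\<lambda>x. a *\<^sub>R frechet_derivative f (at x) v + b *\<^sub>R frechet_derivative g (at x) v)"
      using Suc by simp
  qed (simp add: frechet_derivative_at[OF D, symmetric])
  then show ?case using D by (auto simp: differentiable_def)
qed

lemma Ck_on_const: "Ck_on k S (\<lambda>_. c)"
  by (induction k arbitrary: c) auto

lemma const_in_smooth_functions: "(\<lambda>_. c) \<in> smooth_functions A"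
  by (auto simp: smooth_functions_def smooth_on_def comp_def Ck_on_const)

lemma smooth_functions_linear_combination:
  assumes "smooth_manifold A" "f \<in> smooth_functions A" "g \<in> smooth_functions A"
  shows "(\<lambda>x. a * f x + b * g x) \<in> smooth_functions A"
  unfolding smooth_functions_def smooth_on_def
proof (intro CollectI ballI, clarify)
  fix U \<phi> k assume U: "(U, \<phi>) \<in> A"
  have "open (\<phi> ` U)" using assms(1) U by (auto simp: smooth_manifold_def)
  moreover have "Ck_on k (\<phi> ` U) (f \<circ> inv_into U \<phi>)" "Ck_on k (\<phi> ` U) (g \<circ> inv_into U \<phi>)"
    using assms(2,3) U by (auto simp: smooth_functions_def smooth_on_def)
  ultimately show "Ck_on k (\<phi> ` U) ((\<lambda>x. a * f x + b * g x) \<circ> inv_into U \<phi>)"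
    using Ck_on_linear_combination[of "\<phi> ` U" k "f \<circ> inv_into U \<phi>" "g \<circ> inv_into U \<phi>" a b]
    by (simp add: comp_def)
qed

section \<open>Tangent spaces read in one chart, and linear combinations of vector fields\<close>

definition coordinate_vector ::
    "('m, 'e::euclidean_space) chart set \<Rightarrow> 'm set \<Rightarrow> ('m \<Rightarrow> 'e) \<Rightarrow> 'm \<Rightarrow> 'e \<Rightarrow> 'm tvec" where
  "coordinate_vector A U \<phi> p w = (\<lambda>f. if f \<in> smooth_functions A
     then frechet_derivative (f \<circ> inv_into U \<phi>) (at (\<phi> p)) w else 0)"

lemma smooth_on_has_derivative:
  assumes "smooth_on S f" "x \<in> S"
  shows "(f has_derivative frechet_derivative f (at x)) (at x)"
proof -
  have "Ck_on (Suc 0) S f" using assms(1) unfolding smooth_on_def by blast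
  then show ?thesis using assms(2) by (simp add: frechet_derivative_works)
qed

lemma smooth_functions_has_derivative:
  assumes "f \<in> smooth_functions A" "(U, \<phi>) \<in> A" "p \<in> U"
  shows "(f \<circ> inv_into U \<phi> has_derivative frechet_derivative (f \<circ> inv_into U \<phi>) (at (\<phi> p))) (at (\<phi> p))"
  using assms by (intro smooth_on_has_derivative[where S = "\<phi> ` U"]) (auto simp: smooth_functions_def)

lemma coordinate_vector_linear_combination:
  assumes "(U, \<phi>) \<in> A" "p \<in> U"
  shows "coordinate_vector A U \<phi> p (a *\<^sub>R v + b *\<^sub>R w) =
    tscale a (coordinate_vector A U \<phi> p v) + tscale b (coordinate_vector A U \<phi> p w)"
proof
  fix f
  show "coordinate_vector A U \<phi> p (a *\<^sub>R v + b *\<^sub>R w) f =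
    (tscale a (coordinate_vector A U \<phi> p v) + tscale b (coordinate_vector A U \<phi> p w)) f"
  proof (cases "f \<in> smooth_functions A")
    case True
    have "linear (frechet_derivative (f \<circ> inv_into U \<phi>) (at (\<phi> p)))"
      using smooth_functions_has_derivative[OF True assms] by (rule has_derivative_linear)
    then show ?thesis
      using True by (simp add: coordinate_vector_def tscale_def linear_add linear_scale)
  qed (simp add: coordinate_vector_def tscale_def)
qed

text \<open>Chain rule: near \<open>\<psi> p\<close> the expression of \<open>f\<close> in the chart
  \<open>\<psi>\<close> is its expression in \<open>\<phi>\<close> after the transition map, so
  \<open>w\<close> is transformed by the Jacobian of that map.\<close>

lemma coordinate_vector_change_chart:
  assumes M: "smooth_manifold A" and U: "(U, \<phi>) \<in> A" "p \<in> U" and V: "(V, \<psi>) \<in> A" "p \<in> V"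
  shows "coordinate_vector A V \<psi> p w = coordinate_vector A U \<phi> p
    (frechet_derivative (\<phi> \<circ> inv_into V \<psi>) (at (\<psi> p)) w)"
proof
  fix f
  show "coordinate_vector A V \<psi> p w f = coordinate_vector A U \<phi> p
    (frechet_derivative (\<phi> \<circ> inv_into V \<psi>) (at (\<psi> p)) w) f"
  proof (cases "f \<in> smooth_functions A")
    case True
    let ?i = "inv_into U \<phi>" and ?j = "inv_into V \<psi>"
    have hU: "homeomorphism U (\<phi> ` U) \<phi> ?i" and hV: "homeomorphism V (\<psi> ` V) \<psi> ?j"
      and oU: "open U" and oV: "open (\<psi> ` V)" "open V"
      and sm: "smooth_on (\<psi> ` (V \<inter> U)) (\<phi> \<circ> ?j)"
      using M U V unfolding smooth_manifold_def by blast+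
    have iU: "?i (\<phi> x) = x" if "x \<in> U" for x using hU that by (simp add: homeomorphism_apply1)
    have iV: "?j (\<psi> x) = x" if "x \<in> V" for x using hV that by (simp add: homeomorphism_apply1)
    \<comment> \<open>The two expressions of \<open>f\<close> agree only on the image of the
      overlap; since this image is open, they have the same derivative at
      \<open>\<psi> p\<close>.\<close>
    have "openin (top_of_set (\<psi> ` V)) (\<psi> ` (V \<inter> U))"
      by (rule homeomorphism_imp_open_map[OF hV]) (simp add: oU openin_open_Int)
    then have op: "open (\<psi> ` (V \<inter> U))" using oV(1) by (simp add: openin_open_eq)
    have mem: "\<psi> p \<in> \<psi> ` (V \<inter> U)" using U V by auto
    have d1: "((\<phi> \<circ> ?j) has_derivative frechet_derivative (\<phi> \<circ> ?j) (at (\<psi> p))) (at (\<psi> p))"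
      using smooth_on_has_derivative[OF sm mem] .
    have d2: "(f \<circ> ?i has_derivative frechet_derivative (f \<circ> ?i) (at (\<phi> p))) (at ((\<phi> \<circ> ?j) (\<psi> p)))"
      using smooth_functions_has_derivative[OF True U] iV[OF V(2)] by simp
    have "((f \<circ> ?i) \<circ> (\<phi> \<circ> ?j) has_derivative
        frechet_derivative (f \<circ> ?i) (at (\<phi> p)) \<circ> frechet_derivative (\<phi> \<circ> ?j) (at (\<psi> p))) (at (\<psi> p))"
      by (rule diff_chain_at[OF d1 d2])
    then have "(f \<circ> ?j has_derivative
        frechet_derivative (f \<circ> ?i) (at (\<phi> p)) \<circ> frechet_derivative (\<phi> \<circ> ?j) (at (\<psi> p))) (at (\<psi> p))"
      by (rule has_derivative_transform_within_open[OF _ op mem]) (auto simp: iU iV)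
    from fun_cong[OF frechet_derivative_at[OF this], of w] show ?thesis
      using True by (simp add: coordinate_vector_def)
  qed (simp add: coordinate_vector_def)
qed

text \<open>The definition lets the chart vary with the tangent vector. By the change of chart one
  fixed chart suffices, which makes the tangent space a linear image of the model space.\<close>

lemma tangent_space_eq_range:
  assumes "smooth_manifold A" "(U, \<phi>) \<in> A" "p \<in> U"
  shows "tangent_space A p = range (coordinate_vector A U \<phi> p)"
proof
  show "tangent_space A p \<subseteq> range (coordinate_vector A U \<phi> p)"
  proof
    fix u assume "u \<in> tangent_space A p"
    then obtain V \<psi> w where "(V, \<psi>) \<in> A" "p \<in> V" "u = coordinate_vector A V \<psi> p w"
      unfolding tangent_space_def coordinate_vector_def by blast
    then show "u \<in> range (coordinate_vector A U \<phi> p)"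
      using coordinate_vector_change_chart[OF assms] by blast
  qed
  show "range (coordinate_vector A U \<phi> p) \<subseteq> tangent_space A p"
    using assms unfolding tangent_space_def coordinate_vector_def by blast
qed

lemma chart_around:
  assumes "smooth_manifold A"
  obtains U \<phi> where "(U, \<phi>) \<in> A" "p \<in> U"
proof -
  have "p \<in> (\<Union>(U, \<phi>)\<in>A. U)" using assms unfolding smooth_manifold_def by simp
  then show ?thesis using that by blast
qed

lemma tangent_space_linear_combination:
  assumes "smooth_manifold A" "u \<in> tangent_space A p" "v \<in> tangent_space A p"
  shows "tscale a u + tscale b v \<in> tangent_space A p"
proof -
  obtain U \<phi> where U: "(U, \<phi>) \<in> A" "p \<in> U" using chart_around[OF assms(1)] .
  show ?thesis
    using assms(2,3) coordinate_vector_linear_combination[OF U, symmetric]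
    unfolding tangent_space_eq_range[OF assms(1) U] by fastforce
qed

lemma vector_field_linear_combination:
  assumes "smooth_manifold A" "vector_field A X" "vector_field A Y"
  shows "vector_field A (a \<odot>\<^sub>c X + b \<odot>\<^sub>c Y)"
proof -
  have "(\<lambda>p. a * X p f + b * Y p f) \<in> smooth_functions A" if "f \<in> smooth_functions A" for f
    using assms that by (intro smooth_functions_linear_combination) (auto simp: vector_field_def)
  then show ?thesis
    using assms tangent_space_linear_combination[OF assms(1)]
    by (simp add: vector_field_def fscale_def) (simp add: tscale_def)
qed

lemma deriv_along_const:
  assumes "vector_field A X"
  shows "deriv_along X (\<lambda>_. c) = 0"
proof
  fix p
  have "X p \<in> tangent_space A p" using assms by (simp add: vector_field_def)
  then show "deriv_along X (\<lambda>_. c) p = 0 p"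
    by (auto simp: tangent_space_def deriv_along_def comp_def)
qed

section \<open>Levi-Civita connection: pairings, Koszul formula, curvature and Lie derivative of the
  metric\<close>

locale levi_civita =
  fixes A :: "('m::{t2_space,second_countable_topology}, 'e::euclidean_space) chart set"
    and g :: "'m metric" and nab :: "'m vfield \<Rightarrow> 'm vfield \<Rightarrow> 'm vfield"
  assumes manifold: "smooth_manifold A"
    and metric: "pseudo_riemannian_metric A g"
    and connection: "levi_civita_connection A g nab"
begin

abbreviation "vf \<equiv> vector_field A"
abbreviation "mt \<equiv> metric_tensor g"

lemma g_sym:
  assumes "u \<in> tangent_space A p" "v \<in> tangent_space A p"
  shows "g p u v = g p v u"
  using metric[unfolded pseudo_riemannian_metric_def, THEN conjunct1] assms by simp

lemma g_linear_combination:
  assumes "u \<in> tangent_space A p" "v \<in> tangent_space A p" "w \<in> tangent_space A p"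
  shows "g p (tscale a u + tscale b v) w = a * g p u w + b * g p v w"
  using metric[unfolded pseudo_riemannian_metric_def, THEN conjunct2, THEN conjunct1] assms by simp

lemma vf_tangent: "vf X \<Longrightarrow> X p \<in> tangent_space A p"
  by (simp add: vector_field_def)

lemma metric_tensor_sym: "vf X \<Longrightarrow> vf Y \<Longrightarrow> mt X Y = mt Y X"
  by (simp add: metric_tensor_def fun_eq_iff g_sym vf_tangent)

lemma metric_tensor_linear_combination:
  assumes "vf X" "vf Y" "vf Z"
  shows "mt (a \<odot>\<^sub>c X + b \<odot>\<^sub>c Y) Z p = a * mt X Z p + b * mt Y Z p"
  using assms by (simp add: metric_tensor_def fscale_def g_linear_combination vf_tangent)

lemma diff_eq_linear_combination: "X - Y = 1 \<odot>\<^sub>c X + (- 1) \<odot>\<^sub>c (Y :: 'm vfield)"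
  by (auto simp: fun_eq_iff fscale_def tscale_def)

lemma vf_diff: "vf X \<Longrightarrow> vf Y \<Longrightarrow> vf (X - Y)"
  unfolding diff_eq_linear_combination by (intro vector_field_linear_combination manifold)

lemma vf_cscale: "vf X \<Longrightarrow> vf (a \<odot>\<^sub>c X)"
  using vector_field_linear_combination[OF manifold, of X X a 0]
  by (auto simp: fscale_def tscale_def plus_fun_def)

lemma metric_tensor_diff:
  "vf X \<Longrightarrow> vf Y \<Longrightarrow> vf Z \<Longrightarrow> mt (X - Y) Z p = mt X Z p - mt Y Z p"
  unfolding diff_eq_linear_combination by (subst metric_tensor_linear_combination) auto

lemma metric_tensor_cscale:
  assumes "vf X" "vf Z" shows "mt (a \<odot>\<^sub>c X) Z p = a * mt X Z p"
proof -
  have "a \<odot>\<^sub>c X = a \<odot>\<^sub>c X + 0 \<odot>\<^sub>c X" by (auto simp: fun_eq_iff fscale_def tscale_def)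
  then have "mt (a \<odot>\<^sub>c X) Z p = mt (a \<odot>\<^sub>c X + 0 \<odot>\<^sub>c X) Z p" by simp
  then show ?thesis using metric_tensor_linear_combination[OF assms(1,1,2), of a 0 p] by simp
qed

lemma vf_nab: "vf X \<Longrightarrow> vf Y \<Longrightarrow> vf (nab X Y)"
  using connection[unfolded levi_civita_connection_def, THEN conjunct1] by simp

lemma torsion_free: "vf X \<Longrightarrow> vf Y \<Longrightarrow> lie_bracket X Y = nab X Y - nab Y X"
  using connection[unfolded levi_civita_connection_def, THEN conjunct2, THEN conjunct2, THEN conjunct1]
  by simp

text \<open>Torsion-freeness writes the bracket as a difference of two covariant derivatives, which
  are vector fields by the axioms of the connection.\<close>

lemma vf_lie_bracket: "vf X \<Longrightarrow> vf Y \<Longrightarrow> vf (lie_bracket X Y)"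
  by (simp add: torsion_free vf_nab vf_diff)

lemma metric_tensor_lie_bracket_swap:
  "vf X \<Longrightarrow> vf Y \<Longrightarrow> vf Z \<Longrightarrow> mt (lie_bracket Y X) Z p = - mt (lie_bracket X Y) Z p"
  by (simp add: torsion_free metric_tensor_diff vf_nab)

lemma metric_tensor_lie_bracket_self:
  "vf X \<Longrightarrow> vf Z \<Longrightarrow> mt (lie_bracket X X) Z p = 0"
  using metric_tensor_lie_bracket_swap[of X X Z p] by simp

lemma metric_compatible:
  "vf X \<Longrightarrow> vf Y \<Longrightarrow> vf Z \<Longrightarrow> deriv_along X (mt Y Z) p = mt (nab X Y) Z p + mt Y (nab X Z) p"
  using connection[unfolded levi_civita_connection_def, THEN conjunct2, THEN conjunct2, THEN conjunct2]
  by simp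

text \<open>The derivative of a constant product is zero, so metric compatibility becomes
  skew-symmetry of \<open>nab X\<close> on this pair.\<close>

lemma metric_compatible_const:
  assumes "vf X" "vf Y" "vf Z" "mt Y Z = (\<lambda>_. c)"
  shows "mt (nab X Y) Z p = - mt (nab X Z) Y p"
  using metric_compatible[OF assms(1-3), of p] assms(4) deriv_along_const[OF assms(1), of c]
    metric_tensor_sym[OF assms(2) vf_nab[OF assms(1,3)]]
  by simp

lemma connection_rules:
  assumes "vf X" "vf Y" "vf Z" "h \<in> smooth_functions A"
  shows "nab (X + Y) Z = nab X Z + nab Y Z"
    and "nab (h \<odot> X) Z = h \<odot> nab X Z"
    and "nab X (Y + Z) = nab X Y + nab X Z"
    and "nab X (h \<odot> Y) = deriv_along X h \<odot> Y + h \<odot> nab X Y"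
  using connection[unfolded levi_civita_connection_def, THEN conjunct2, THEN conjunct1] assms
  by simp_all

lemma nab_linear_combination_left:
  assumes "vf X" "vf Y" "vf Z"
  shows "nab (a \<odot>\<^sub>c X + b \<odot>\<^sub>c Y) Z = a \<odot>\<^sub>c nab X Z + b \<odot>\<^sub>c nab Y Z"
  using connection_rules(1)[OF vf_cscale[OF assms(1)] vf_cscale[OF assms(2)] assms(3) const_in_smooth_functions]
    connection_rules(2)[OF assms(1,2,3) const_in_smooth_functions]
    connection_rules(2)[OF assms(2,2,3) const_in_smooth_functions]
  by simp

lemma nab_cscale_right:
  assumes "vf X" "vf Y"
  shows "nab X (a \<odot>\<^sub>c Y) = a \<odot>\<^sub>c nab X Y"
proof -
  have "(0 :: 'm \<Rightarrow> real) \<odot> Y = 0"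
    by (auto simp: fscale_def tscale_def fun_eq_iff)
  then show ?thesis
    using connection_rules(4)[OF assms(1,2,2) const_in_smooth_functions, of a]
    by (simp add: deriv_along_const[OF assms(1)])
qed

lemma nab_linear_combination_right:
  assumes "vf X" "vf Y" "vf Z"
  shows "nab X (a \<odot>\<^sub>c Y + b \<odot>\<^sub>c Z) = a \<odot>\<^sub>c nab X Y + b \<odot>\<^sub>c nab X Z"
  using assms by (simp add: connection_rules(3)[OF _ _ _ const_in_smooth_functions] vf_cscale nab_cscale_right)

text \<open>The derivative terms of the Koszul formula vanish for constant products. What remains
  follows from skew-symmetry of \<open>nab X\<close>, \<open>nab Y\<close> and \<open>nab Z\<close>,
  applied cyclically, together with torsion-freeness.\<close>

lemma koszul_const:
  assumes v: "vf X" "vf Y" "vf Z"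
    and c: "mt Y Z = (\<lambda>_. a)" "mt X Z = (\<lambda>_. b)" "mt X Y = (\<lambda>_. c)"
  shows "mt (nab X Y) Z p =
    (mt (lie_bracket X Y) Z p - mt (lie_bracket Y Z) X p + mt (lie_bracket Z X) Y p) / 2"
proof -
  have c': "mt Z X = (\<lambda>_. b)" using c v by (simp add: metric_tensor_sym)
  show ?thesis
    using metric_compatible_const[OF v c(1), of p] metric_compatible_const[OF v(2,3,1) c', of p]
      metric_compatible_const[OF v(3,1,2) c(3), of p]
    by (simp add: torsion_free v metric_tensor_diff vf_nab)
qed

text \<open>Metric compatibility moves the outer derivative of \<open>\<nabla>\<^sub>X \<nabla>\<^sub>Y Z\<close> onto \<open>W\<close>, so that
  only first covariant derivatives of the frame fields are needed.\<close>

lemma curvature_tensor_const: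
  assumes v: "vf X" "vf Y" "vf Z" "vf W"
    and c: "mt (nab Y Z) W = (\<lambda>_. a)" "mt (nab X Z) W = (\<lambda>_. b)"
  shows "curvature_tensor g nab X Y Z W p =
    mt (nab Y Z) (nab X W) p - mt (nab X Z) (nab Y W) p + mt (nab (lie_bracket X Y) Z) W p"
proof -
  have "mt (nab X (nab Y Z)) W p = - mt (nab Y Z) (nab X W) p"
       "mt (nab Y (nab X Z)) W p = - mt (nab X Z) (nab Y W) p"
    using metric_compatible_const[OF v(1) vf_nab[OF v(2,3)] v(4) c(1), of p]
      metric_compatible_const[OF v(2) vf_nab[OF v(1,3)] v(4) c(2), of p]
      metric_tensor_sym[OF vf_nab[OF v(2,3)] vf_nab[OF v(1,4)]]
      metric_tensor_sym[OF vf_nab[OF v(1,3)] vf_nab[OF v(2,4)]]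
    by simp_all
  then show ?thesis
    by (simp add: curvature_tensor_def curvature_def metric_tensor_diff v vf_nab vf_diff vf_lie_bracket)
qed

text \<open>Replacing each bracket \<open>[V, X]\<close> by \<open>nab V X - nab X V\<close>, the
  terms differentiated along \<open>V\<close> cancel by metric compatibility. The rest depends on
  \<open>V\<close> only through its covariant derivatives.\<close>

lemma lie_derivative_metric_tensor:
  assumes "vf V" "vf X" "vf Y"
  shows "lie_derivative V mt X Y p = mt (nab X V) Y p + mt (nab Y V) X p"
proof -
  have "mt X (nab V Y - nab Y V) = mt (nab V Y - nab Y V) X" "mt X (nab V Y) = mt (nab V Y) X"
    using assms by (simp_all only: metric_tensor_sym[OF assms(2)] vf_nab vf_diff)
  then show ?thesis
    using metric_compatible[OF assms, of p] assms
    by (simp add: lie_derivative_def torsion_free metric_tensor_diff vf_nab)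
qed

end

section \<open>Pseudo-orthonormal frames in dimension three\<close>

locale lorentz_frame = levi_civita A g nab
  for A :: "('m::{t2_space,second_countable_topology}, real^3) chart set" and g nab +
  fixes e1 e2 e3 :: "'m vfield"
  assumes vf_frame: "vf e1" "vf e2" "vf e3"
    and orthonormal: "pseudo_orthonormal g e1 e2 e3"
begin

lemma metric_frame:
  "mt e1 e1 = (\<lambda>_. 1)" "mt e2 e2 = (\<lambda>_. 1)" "mt e3 e3 = (\<lambda>_. - 1)"
  "mt e1 e2 = (\<lambda>_. 0)" "mt e2 e1 = (\<lambda>_. 0)" "mt e1 e3 = (\<lambda>_. 0)" "mt e3 e1 = (\<lambda>_. 0)"
  "mt e2 e3 = (\<lambda>_. 0)" "mt e3 e2 = (\<lambda>_. 0)"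
  using orthonormal g_sym[OF vf_frame(1,2)[THEN vf_tangent]]
    g_sym[OF vf_frame(1,3)[THEN vf_tangent]] g_sym[OF vf_frame(2,3)[THEN vf_tangent]]
  by (simp_all add: pseudo_orthonormal_def metric_tensor_def fun_eq_iff)

lemma metric_frame_combination:
  assumes "w \<in> tangent_space A p"
  shows "g p (tscale a (e1 p) + tscale b (e2 p) + tscale c (e3 p)) w =
    a * g p (e1 p) w + b * g p (e2 p) w + c * g p (e3 p) w"
proof -
  have "tscale 1 u = u" for u :: "'m tvec" by (simp add: tscale_def)
  then show ?thesis
    using g_linear_combination[of "tscale a (e1 p) + tscale b (e2 p)" p "e3 p" w 1 c]
      g_linear_combination[of "e1 p" p "e2 p" w a b]
      tangent_space_linear_combination[OF manifold, of "e1 p" p "e2 p" a b]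
      assms vf_frame[THEN vf_tangent, of p]
    by simp
qed

text \<open>A dimension count: orthonormality makes the coefficient map into the chart's
  \<open>real^3\<close> injective, and an injective linear endomorphism of \<open>real^3\<close> is
  onto.\<close>

lemma frame_spans:
  assumes "u \<in> tangent_space A p"
  obtains a b c where "u = tscale a (e1 p) + tscale b (e2 p) + tscale c (e3 p)"
proof -
  obtain U \<phi> where U: "(U, \<phi>) \<in> A" "p \<in> U" using chart_around[OF manifold] .
  let ?T = "coordinate_vector A U \<phi> p"
  note range = tangent_space_eq_range[OF manifold U]
  obtain w1 w2 w3 where w: "e1 p = ?T w1" "e2 p = ?T w2" "e3 p = ?T w3"
    using vf_frame[THEN vf_tangent, of p] unfolding range by blast
  \<comment> \<open>\<open>w1\<close>, \<open>w2\<close>, \<open>w3\<close> are chart coordinates of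
    the frame vectors; \<open>L\<close> sends frame coefficients to chart coordinates.\<close>
  define L :: "real^3 \<Rightarrow> real^3" where "L c = c $ 1 *\<^sub>R w1 + c $ 2 *\<^sub>R w2 + c $ 3 *\<^sub>R w3" for c
  have TL: "?T (L c) = tscale (c $ 1) (e1 p) + tscale (c $ 2) (e2 p) + tscale (c $ 3) (e3 p)" for c
    using coordinate_vector_linear_combination[OF U, of 1 "c $ 1 *\<^sub>R w1 + c $ 2 *\<^sub>R w2" "c $ 3" w3]
      coordinate_vector_linear_combination[OF U, of "c $ 1" w1 "c $ 2" w2]
    unfolding L_def w by (simp add: tscale_def fun_eq_iff)
  have "linear L"
    unfolding L_def by (intro linearI) (auto simp: algebra_simps)
  moreover have "c = 0" if "L c = 0" for c
  proof -
    have "?T (L c) = tscale 0 (e1 p) + tscale 0 (e2 p) + tscale 0 (e3 p)"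
      using TL[of 0] that \<open>linear L\<close> by (simp add: linear_0)
    then have "tscale (c $ 1) (e1 p) + tscale (c $ 2) (e2 p) + tscale (c $ 3) (e3 p) =
      tscale 0 (e1 p) + tscale 0 (e2 p) + tscale 0 (e3 p)" using TL by simp
    \<comment> \<open>Pairing the zero combination with \<open>e1\<close>, \<open>e2\<close>,
      \<open>e3\<close> returns \<open>c $ 1\<close>, \<open>c $ 2\<close> and
      \<open>- c $ 3\<close>, so all coefficients vanish.\<close>
    then have "c $ 1 * g p (e1 p) w + c $ 2 * g p (e2 p) w + c $ 3 * g p (e3 p) w = 0"
      if "w \<in> tangent_space A p" for w
      using metric_frame_combination[OF that, of "c $ 1" "c $ 2" "c $ 3"]
        metric_frame_combination[OF that, of 0 0 0] by simp
    from this[of "e1 p"] this[of "e2 p"] this[of "e3 p"] show "c = 0"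
      using metric_frame vf_frame[THEN vf_tangent, of p]
      by (simp add: metric_tensor_def fun_eq_iff vec_eq_iff forall_3)
  qed
  ultimately have "surj L"
    using linear_injective_imp_surjective linear_injective_0 by blast
  obtain c where "u = ?T (L c)" using assms \<open>surj L\<close> unfolding range by (metis imageE surjD)
  then show ?thesis using TL that by metis
qed

text \<open>Pairing with the frame recovers the coefficients of \<open>X p\<close>, except that
  \<open>e3\<close> is timelike: its coefficient is \<open>- mt X e3 p\<close>, whence the minus
  sign.\<close>

lemma metric_tensor_expansion:
  assumes "vf X" "vf Y"
  shows "mt X Y p = mt X e1 p * mt Y e1 p + mt X e2 p * mt Y e2 p - mt X e3 p * mt Y e3 p"
proof -
  note t = vf_frame[THEN vf_tangent, of p] assms[THEN vf_tangent, of p]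
  note fr = metric_frame[unfolded metric_tensor_def fun_eq_iff, rule_format]
  obtain a b c where X: "X p = tscale a (e1 p) + tscale b (e2 p) + tscale c (e3 p)"
    using frame_spans[OF t(4)] .
  have "g p (X p) w = a * g p w (e1 p) + b * g p w (e2 p) + c * g p w (e3 p)"
    if "w \<in> tangent_space A p" for w
    using metric_frame_combination[OF that, of a b c] t that by (simp add: X g_sym)
  from this[OF t(5)] this[OF t(1)] this[OF t(2)] this[OF t(3)] show ?thesis
    unfolding metric_tensor_def by (simp add: fr)
qed

text \<open>Restricted to products of two covariant derivatives, because the general expansion would
  apply again to its own right-hand side.\<close>

lemma metric_tensor_nab_expansion:
  assumes "vf X" "vf Y" "vf Z" "vf W"
  shows "mt (nab X Y) (nab Z W) p = mt (nab X Y) e1 p * mt (nab Z W) e1 p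
    + mt (nab X Y) e2 p * mt (nab Z W) e2 p - mt (nab X Y) e3 p * mt (nab Z W) e3 p"
  using assms by (intro metric_tensor_expansion vf_nab)

text \<open>All products of frame fields are constant, so the connection is determined on the frame
  by the brackets alone.\<close>

lemma koszul_frame:
  assumes "X \<in> {e1, e2, e3}" "Y \<in> {e1, e2, e3}" "Z \<in> {e1, e2, e3}"
  shows "mt (nab X Y) Z p =
    (mt (lie_bracket X Y) Z p - mt (lie_bracket Y Z) X p + mt (lie_bracket Z X) Y p) / 2"
proof -
  have c: "\<exists>c. mt X Y = (\<lambda>_. c)" if "X \<in> {e1, e2, e3}" "Y \<in> {e1, e2, e3}" for X Y
    using that metric_frame by blast
  obtain a b c where "mt Y Z = (\<lambda>_. a)" "mt X Z = (\<lambda>_. b)" "mt X Y = (\<lambda>_. c)"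
    using c assms by meson
  moreover have "vf X" "vf Y" "vf Z" using assms vf_frame by auto
  ultimately show ?thesis by (intro koszul_const)
qed

end

section \<open>Connection, curvature and Lie derivative for the bracket relations of the
  group\<close>

locale G2_frame = lorentz_frame +
  fixes \<alpha> \<beta> \<gamma> :: real
  assumes bracket12: "lie_bracket e1 e2 = \<gamma> \<odot>\<^sub>c e2 - \<beta> \<odot>\<^sub>c e3"
    and bracket13: "lie_bracket e1 e3 = (- \<beta>) \<odot>\<^sub>c e2 - \<gamma> \<odot>\<^sub>c e3"
    and bracket23: "lie_bracket e2 e3 = \<alpha> \<odot>\<^sub>c e1"
begin

text \<open>These are pairings with \<open>e_k\<close>, not coefficients: the \<open>e3\<close>
  coefficient of a covariant derivative has the opposite sign. The pairing of
  \<open>nab e_i e_j\<close> with \<open>e_k\<close> is entry number 9(i-1) + 3(j-1) + k.\<close>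

lemma christoffel:
  "mt (nab e1 e1) e1 = (\<lambda>_. 0)" "mt (nab e1 e1) e2 = (\<lambda>_. 0)" "mt (nab e1 e1) e3 = (\<lambda>_. 0)"
  "mt (nab e1 e2) e1 = (\<lambda>_. 0)" "mt (nab e1 e2) e2 = (\<lambda>_. 0)" "mt (nab e1 e2) e3 = (\<lambda>_. \<beta> - \<alpha> / 2)"
  "mt (nab e1 e3) e1 = (\<lambda>_. 0)" "mt (nab e1 e3) e2 = (\<lambda>_. \<alpha> / 2 - \<beta>)" "mt (nab e1 e3) e3 = (\<lambda>_. 0)"
  "mt (nab e2 e1) e1 = (\<lambda>_. 0)" "mt (nab e2 e1) e2 = (\<lambda>_. - \<gamma>)" "mt (nab e2 e1) e3 = (\<lambda>_. - \<alpha> / 2)"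
  "mt (nab e2 e2) e1 = (\<lambda>_. \<gamma>)" "mt (nab e2 e2) e2 = (\<lambda>_. 0)" "mt (nab e2 e2) e3 = (\<lambda>_. 0)"
  "mt (nab e2 e3) e1 = (\<lambda>_. \<alpha> / 2)" "mt (nab e2 e3) e2 = (\<lambda>_. 0)" "mt (nab e2 e3) e3 = (\<lambda>_. 0)"
  "mt (nab e3 e1) e1 = (\<lambda>_. 0)" "mt (nab e3 e1) e2 = (\<lambda>_. \<alpha> / 2)" "mt (nab e3 e1) e3 = (\<lambda>_. - \<gamma>)"
  "mt (nab e3 e2) e1 = (\<lambda>_. - \<alpha> / 2)" "mt (nab e3 e2) e2 = (\<lambda>_. 0)" "mt (nab e3 e2) e3 = (\<lambda>_. 0)"
  "mt (nab e3 e3) e1 = (\<lambda>_. \<gamma>)" "mt (nab e3 e3) e2 = (\<lambda>_. 0)" "mt (nab e3 e3) e3 = (\<lambda>_. 0)"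
  by (simp_all add: fun_eq_iff koszul_frame metric_tensor_lie_bracket_self
      metric_tensor_lie_bracket_swap[of e1 e2] metric_tensor_lie_bracket_swap[of e1 e3]
      metric_tensor_lie_bracket_swap[of e2 e3] bracket12 bracket13 bracket23 metric_tensor_diff
      metric_tensor_cscale vf_cscale vf_frame metric_frame field_simps)

lemma nab_bracket:
  assumes "vf Z" "vf W"
  shows "mt (nab (lie_bracket e1 e2) Z) W p = \<gamma> * mt (nab e2 Z) W p - \<beta> * mt (nab e3 Z) W p"
    and "mt (nab (lie_bracket e1 e3) Z) W p = - \<beta> * mt (nab e2 Z) W p - \<gamma> * mt (nab e3 Z) W p"
    and "mt (nab (lie_bracket e2 e3) Z) W p = \<alpha> * mt (nab e1 Z) W p"
proof -
  have d: "a \<odot>\<^sub>c X - b \<odot>\<^sub>c Y = a \<odot>\<^sub>c X + (- b) \<odot>\<^sub>c Y" for a b and X Y :: "'a vfield"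
    by (auto simp: fun_eq_iff fscale_def tscale_def)
  show "mt (nab (lie_bracket e1 e2) Z) W p = \<gamma> * mt (nab e2 Z) W p - \<beta> * mt (nab e3 Z) W p"
    and "mt (nab (lie_bracket e1 e3) Z) W p = - \<beta> * mt (nab e2 Z) W p - \<gamma> * mt (nab e3 Z) W p"
    using assms vf_frame unfolding bracket12 bracket13 d
    by (simp_all add: nab_linear_combination_left metric_tensor_linear_combination vf_nab)
  show "mt (nab (lie_bracket e2 e3) Z) W p = \<alpha> * mt (nab e1 Z) W p"
    using assms vf_frame unfolding bracket23
    by (simp add: connection_rules(2)[OF _ _ _ const_in_smooth_functions] metric_tensor_cscale vf_nab)
qed

lemma curvature_components:
  "curvature_tensor g nab e1 e2 e3 e1 p = \<gamma> * (\<alpha> - 2 * \<beta>)"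
  "curvature_tensor g nab e1 e2 e2 e1 p = \<gamma>\<^sup>2 + \<alpha>\<^sup>2 / 4"
  "curvature_tensor g nab e1 e3 e3 e1 p = - \<gamma>\<^sup>2 - \<alpha>\<^sup>2 / 4"
  "curvature_tensor g nab e2 e3 e3 e2 p = \<gamma>\<^sup>2 + 3 * \<alpha>\<^sup>2 / 4 - \<alpha> * \<beta>"
  \<comment> \<open>For each component the two chosen entries are the constants
    \<open>mt (nab Y Z) W\<close> and \<open>mt (nab X Z) W\<close> that
    \<open>curvature_tensor_const\<close> asks for.\<close>
  by (simp_all add: curvature_tensor_const[OF _ _ _ _ christoffel(16) christoffel(7)]
      curvature_tensor_const[OF _ _ _ _ christoffel(13) christoffel(4)]
      curvature_tensor_const[OF _ _ _ _ christoffel(25) christoffel(7)]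
      curvature_tensor_const[OF _ _ _ _ christoffel(26) christoffel(17)]
      vf_frame metric_tensor_nab_expansion nab_bracket christoffel field_simps power2_eq_square)

text \<open>Constant coefficients let \<open>nab X V\<close> be expanded over the frame. On the
  diagonal only the pairings of \<open>nab e2 e1\<close> with \<open>e2\<close> and of
  \<open>nab e3 e1\<close> with \<open>e3\<close> survive, both equal to \<open>- \<gamma>\<close>.
  For the pair \<open>e2\<close>, \<open>e3\<close> the two contributions of \<open>e1\<close> are
  opposite, \<open>- \<alpha> / 2\<close> and \<open>\<alpha> / 2\<close>.\<close>

lemma lie_derivative_components:
  fixes l1 l2 l3 :: real
  defines "V \<equiv> l1 \<odot>\<^sub>c e1 + l2 \<odot>\<^sub>c e2 + l3 \<odot>\<^sub>c e3"
  shows "lie_derivative V mt e1 e1 p = 0"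
    and "lie_derivative V mt e2 e2 p = - 2 * l1 * \<gamma>"
    and "lie_derivative V mt e3 e3 p = - 2 * l1 * \<gamma>"
    and "lie_derivative V mt e2 e3 p = 0"
proof -
  let ?U = "l1 \<odot>\<^sub>c e1 + l2 \<odot>\<^sub>c e2"
  have U: "vf ?U" using vf_frame by (intro vector_field_linear_combination manifold)
  have one: "1 \<odot>\<^sub>c X = X" for X :: "'a vfield" by (simp add: fun_eq_iff fscale_def tscale_def)
  have V: "vf V"
    using vector_field_linear_combination[OF manifold U vf_frame(3), of 1 l3] by (simp add: V_def one)
  have nV: "mt (nab X V) Y p = l1 * mt (nab X e1) Y p + l2 * mt (nab X e2) Y p + l3 * mt (nab X e3) Y p"
    if "vf X" "vf Y" for X Y
  proof -
    have "nab X V = 1 \<odot>\<^sub>c (l1 \<odot>\<^sub>c nab X e1 + l2 \<odot>\<^sub>c nab X e2) + l3 \<odot>\<^sub>c nab X e3"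
      using nab_linear_combination_right[OF that(1) U vf_frame(3), of 1 l3]
        nab_linear_combination_right[OF that(1) vf_frame(1,2), of l1 l2]
      by (simp add: V_def one)
    then show ?thesis
      using that vf_frame
      by (simp add: metric_tensor_linear_combination vector_field_linear_combination manifold vf_nab)
  qed
  show "lie_derivative V mt e1 e1 p = 0"
    and "lie_derivative V mt e2 e2 p = - 2 * l1 * \<gamma>"
    and "lie_derivative V mt e3 e3 p = - 2 * l1 * \<gamma>"
    and "lie_derivative V mt e2 e3 p = 0"
    by (simp_all add: lie_derivative_metric_tensor V vf_frame nV christoffel)
qed

end

theorem theorem2p2:
  fixes \<alpha> \<beta> \<gamma> :: real
    and A :: "('g::{t2_space,second_countable_topology}, real^3) chart set"
    and mul :: "'g \<Rightarrow> 'g \<Rightarrow> 'g" and e :: 'g and iv :: "'g \<Rightarrow> 'g"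
    and g :: "'g metric" and nab :: "'g vfield \<Rightarrow> 'g vfield \<Rightarrow> 'g vfield"
    and e1 e2 e3 V :: "'g vfield"
    and l1 l2 l3 lam :: real
  assumes "\<gamma> \<noteq> 0"
    and "lie_group A mul e iv"
    and "connected (UNIV :: 'g set)" and "simply_connected (UNIV :: 'g set)"
    and "lorentzian_metric A g" and "left_invariant_metric A mul g"
    and "levi_civita_connection A g nab"
    and "lie_algebra_basis A mul e1 e2 e3"
    and "pseudo_orthonormal g e1 e2 e3"
    and "lie_bracket e1 e2 = \<gamma> \<odot>\<^sub>c e2 - \<beta> \<odot>\<^sub>c e3"
    and "lie_bracket e1 e3 = (- \<beta>) \<odot>\<^sub>c e2 - \<gamma> \<odot>\<^sub>c e3"
    and "lie_bracket e2 e3 = \<alpha> \<odot>\<^sub>c e1"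
    and "V = l1 \<odot>\<^sub>c e1 + l2 \<odot>\<^sub>c e2 + l3 \<odot>\<^sub>c e3"
  shows "\<not> riemann_soliton A g nab V lam"
proof
  assume soliton: "riemann_soliton A g nab V lam"
  have smooth: "smooth_manifold A" using assms(2) by (simp add: lie_group_def)
  have metric: "pseudo_riemannian_metric A g" using assms(5) by (simp add: lorentzian_metric_def)
  have vf: "vector_field A e1" "vector_field A e2" "vector_field A e3"
    using assms(8) by (auto simp: lie_algebra_basis_def left_invariant_def)
  interpret G2_frame A g nab e1 e2 e3 \<alpha> \<beta> \<gamma>
    by unfold_locales (fact smooth metric assms vf)+
  have sol: "curvature_tensor g nab X Y Z W p
      + (lie_derivative V mt X W p * mt Y Z p + lie_derivative V mt Y Z p * mt X W p
        - lie_derivative V mt X Z p * mt Y W p - lie_derivative V mt Y W p * mt X Z p) / 2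
      = lam * (mt X W p * mt Y Z p - mt X Z p * mt Y W p)"
    if "vf X" "vf Y" "vf Z" "vf W" for X Y Z W p
    using soliton[unfolded riemann_soliton_def, rule_format, of X Y Z W p] that
    by (simp add: kulkarni_nomizu_def field_simps)
  note comp = curvature_components lie_derivative_components[of l1 l2 l3, folded assms(13)] metric_frame
  \<comment> \<open>The only nonzero metric factor is \<open>mt e1 e1\<close>, which multiplies the
    component of the Lie derivative at \<open>e2\<close>, \<open>e3\<close>; that component is
    zero.\<close>
  have "\<gamma> * (\<alpha> - 2 * \<beta>) = 0" using sol[OF vf(1,2,3,1)] by (simp add: comp)
  then have \<alpha>: "\<alpha> = 2 * \<beta>" using \<open>\<gamma> \<noteq> 0\<close> by simp
  have "\<gamma>\<^sup>2 + \<beta>\<^sup>2 - l1 * \<gamma> = lam"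
    using sol[OF vf(1,2,2,1)] by (simp add: comp \<alpha> power2_eq_square)
  \<comment> \<open>Since \<open>e3\<close> is timelike, the curvature and the right-hand side
    change sign against the previous equation while \<open>l1 * \<gamma>\<close> does not. Adding
    the two equations gives \<open>l1 * \<gamma> = 0\<close>.\<close>
  moreover have "- \<gamma>\<^sup>2 - \<beta>\<^sup>2 - l1 * \<gamma> = - lam"
    using sol[OF vf(1,3,3,1)] by (simp add: comp \<alpha> power2_eq_square)
  \<comment> \<open>\<open>V\<close> drops out: the equal diagonal components at \<open>e2\<close>
    and \<open>e3\<close> are multiplied by metric factors of opposite sign.\<close>
  moreover have "\<gamma>\<^sup>2 + \<beta>\<^sup>2 = - lam"
    using sol[OF vf(2,3,3,2)] by (simp add: comp \<alpha> power2_eq_square)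
  ultimately have "\<gamma>\<^sup>2 + \<beta>\<^sup>2 = 0" by linarith
  then show False using \<open>\<gamma> \<noteq> 0\<close> by (simp add: sum_power2_eq_zero_iff)
qed

end
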